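(* Let $q\ge2$ be an integer and let $\psi:[0,1]\to[0,1]$ be defined by $\psi(x)=qx-\lfloor qx\rfloor$. If $X\subset[0,1]$ is a nonempty compact set such that $\psi(X)\subset X$ with upper box dimension equal to $s$, then the Hausdorff measure of dimension $s$ of $X$ is greater than or equal to $q^{-s}/2$ (or infinite). In particular, the upper box dimension and the Hausdorff dimension of $X$ coincide.
   Context: The Hausdorff measure of dimension $s$ is the usual (unnormalized) one, $\mathcal{H}^s(X)=\lim_{\delta\to0}\inf\{\sum_j|U_j|^s: X\subset\bigcup_jU_j,\ |U_j|\le\delta\}$, where the infimum is over countable covers and $|U|$ denotes the diameter of $U$. *)

theory Defs
  imports "HOL-Analysis.Analysis"
begin

text \<open>The library's \<open>diameter\<close> is real-valued and has no meaning for unbounded sets, so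
  ``diameter at most \<open>\<delta>\<close>'' always comes with boundedness. The conventions for
  \<open>\<bar>U\<bar>\<^sup>s\<close> are the usual ones: the empty set contributes 0, and a nonempty set contributes 1
  if \<open>s = 0\<close>, also when its diameter is 0 (whereas \<open>0 powr 0 = 0\<close>).\<close>

definition diam_le :: "real \<Rightarrow> 'a::metric_space set \<Rightarrow> bool" where
  "diam_le \<delta> U \<longleftrightarrow> bounded U \<and> diameter U \<le> \<delta>"

definition diam_pow :: "real \<Rightarrow> 'a::metric_space set \<Rightarrow> ennreal" where
  "diam_pow s U =
     (if U = {} then 0 else if s = 0 then 1 else ennreal (diameter U powr s))"

text \<open>Finite covers are included, since the \<open>U j\<close> may be empty.\<close>

definition hausdorff_content :: "real \<Rightarrow> real \<Rightarrow> 'a::metric_space set \<Rightarrow> ennreal" where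
  "hausdorff_content s \<delta> X =
     Inf {(\<Sum>j. diam_pow s (U j)) | U :: nat \<Rightarrow> 'a set.
            X \<subseteq> (\<Union>j. U j) \<and> (\<forall>j. diam_le \<delta> (U j))}"

definition hausdorff_measure :: "real \<Rightarrow> 'a::metric_space set \<Rightarrow> ennreal" where
  "hausdorff_measure s X = Lim (at_right 0) (\<lambda>\<delta>. hausdorff_content s \<delta> X)"

lemma hausdorff_content_antimono:
  assumes "\<delta> \<le> \<epsilon>"
  shows "hausdorff_content s \<epsilon> X \<le> hausdorff_content s \<delta> X"
proof -
  have "diam_le \<epsilon> U" if "diam_le \<delta> U" for U :: "'a set"
    using that assms by (simp add: diam_le_def)
  then show ?thesis
    unfolding hausdorff_content_def by (intro Inf_superset_mono) blast
qed

text \<open>The limit exists, so \<^const>\<open>Lim\<close> is meaningful here.\<close>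

lemma hausdorff_content_tendsto:
  "((\<lambda>\<delta>. hausdorff_content s \<delta> X) \<longlongrightarrow> (SUP \<delta>\<in>{0<..}. hausdorff_content s \<delta> X)) (at_right 0)"
proof (rule order_tendstoI)
  fix a assume "a < (SUP \<delta>\<in>{0<..}. hausdorff_content s \<delta> X)"
  then obtain \<epsilon> where "\<epsilon> > 0" "a < hausdorff_content s \<epsilon> X"
    by (auto simp: less_SUP_iff)
  moreover have "\<forall>\<^sub>F \<delta> in at_right 0. \<delta> < \<epsilon>"
    using \<open>\<epsilon> > 0\<close> by (auto simp: eventually_at_right_field)
  ultimately show "\<forall>\<^sub>F \<delta> in at_right 0. a < hausdorff_content s \<delta> X"
    by (metis (mono_tags, lifting) eventually_mono hausdorff_content_antimono
        less_imp_le less_le_trans)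
next
  fix a assume *: "(SUP \<delta>\<in>{0<..}. hausdorff_content s \<delta> X) < a"
  have "\<forall>\<^sub>F \<delta> in at_right 0. (0::real) < \<delta>"
    by (simp add: eventually_at_right_less)
  then show "\<forall>\<^sub>F \<delta> in at_right 0. hausdorff_content s \<delta> X < a"
    by eventually_elim (rule le_less_trans[OF SUP_upper *], simp)
qed

lemma hausdorff_measure_eq_SUP:
  "hausdorff_measure s X = (SUP \<delta>\<in>{0<..}. hausdorff_content s \<delta> X)"
  unfolding hausdorff_measure_def
  by (rule tendsto_Lim[OF trivial_limit_at_right_real hausdorff_content_tendsto])

definition hausdorff_dim :: "'a::metric_space set \<Rightarrow> ereal" where
  "hausdorff_dim X = Inf {ereal t | t. t \<ge> 0 \<and> hausdorff_measure t X = 0}"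

text \<open>Intended for totally bounded \<open>X\<close> and \<open>\<delta> > 0\<close>, where such finite covers exist.\<close>

definition covering_number :: "real \<Rightarrow> 'a::metric_space set \<Rightarrow> nat" where
  "covering_number \<delta> X =
     (LEAST n. \<exists>\<U>. finite \<U> \<and> card \<U> = n \<and> X \<subseteq> \<Union>\<U> \<and> (\<forall>U\<in>\<U>. diam_le \<delta> U))"

definition upper_box_dim :: "'a::metric_space set \<Rightarrow> ereal" where
  "upper_box_dim X =
     Limsup (at_right 0) (\<lambda>\<delta>. ereal (ln (real (covering_number \<delta> X)) / - ln \<delta>))"

definition mult_map :: "int \<Rightarrow> real \<Rightarrow> real" where
  "mult_map q x = of_int q * x - of_int \<lfloor>of_int q * x\<rfloor>"

end

theory Submission
  imports Defs
begin

text \<open>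
  Cut the line into the half-open \<open>q\<close>-adic cells
  \<open>[a/q\<^sup>n, (a+1)/q\<^sup>n)\<close> and let \<open>N n\<close> count the cells of rank \<open>n\<close> that meet \<open>X\<close>. The
  \<open>k\<close>-th iterate of the map stretches each cell of rank \<open>k\<close> affinely onto \<open>[0, 1)\<close>, so by
  invariance the part of \<open>X\<close> in such a cell is contained in a copy of \<open>X\<close> scaled by \<open>q\<^sup>-\<^sup>k\<close>, and
  it meets at most \<open>N (n - k)\<close> cells of rank \<open>n\<close>. Hence a finite cover of \<open>X\<close> by cells of ranks
  \<open>k j \<ge> 1\<close> gives, for large \<open>n\<close>, the recursive inequality \<open>N n \<le> (\<Sum>j. N (n - k j))\<close>
  (\<open>card_adic_cells_le_sum\<close>). If \<open>(\<Sum>j. q powr (- t * k j)) \<le> 1\<close>, induction on \<open>n\<close> turns this into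
  \<open>N n \<le> C * q powr (t * n)\<close> (\<open>adic_cells_growth\<close>), which bounds the upper box dimension by \<open>t\<close>.
  A finite sum depends continuously on \<open>t\<close>; so if the inequality is strict for \<open>t = s\<close>, it still
  holds for some \<open>t < s\<close>, and the upper box dimension is strictly less than \<open>s\<close>
  (\<open>upper_box_dim_less_of_adic_cover\<close>).

  Now let \<open>s > 0\<close> be the upper box dimension, and suppose that some cover of \<open>X\<close> had
  \<open>(\<Sum>j. \<bar>U j\<bar> powr s) < q powr (- s) / 2\<close>. By compactness it may be replaced by finitely many
  open intervals of lengths \<open>d j\<close> satisfying the same bound. An interval of length \<open>d \<le> 1\<close> lies in
  two adjacent cells of length at most \<open>q * d\<close>. These cells cover \<open>X\<close>, and their lengths to the
  power \<open>s\<close> add up to at most \<open>2 * q powr s * (\<Sum>j. d j powr s) < 1\<close>, which is impossible by the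
  previous paragraph. So \<open>q powr (- s) / 2\<close> bounds from below the Hausdorff contents of \<open>X\<close> at
  every scale (\<open>hausdorff_content_ge\<close>), and in particular the Hausdorff measure. For \<open>s = 0\<close> this
  is clear, since every nonempty set in a cover counts 1.

  For sets of diameter at most 1 a smaller exponent gives a larger content, so the contents of
  exponent \<open>t < s\<close> are positive as well, whence the Hausdorff dimension is at least \<open>s\<close>. The
  opposite inequality holds for every nonempty compact set (\<open>hausdorff_dim_le_upper_box_dim\<close>).
\<close>

section \<open>Counting \<open>q\<close>-adic cells of an invariant set\<close>

text \<open>The cell \<open>[a/q\<^sup>n, (a+1)/q\<^sup>n)\<close> is represented by the integer \<open>a\<close>. Taking cells
  half-open makes each point belong to exactly one cell of each rank, and the point 1 fits in as the
  left end of the cell with \<open>a = q\<^sup>n\<close>.\<close>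

definition adic_cells :: "int \<Rightarrow> nat \<Rightarrow> real set \<Rightarrow> int set" where
  "adic_cells q n X = (\<lambda>x. \<lfloor>of_int q ^ n * x\<rfloor>) ` X"

lemma finite_adic_cells:
  assumes "bounded X"
  shows "finite (adic_cells q n X)"
proof -
  have "bounded ((\<lambda>x. of_int q ^ n * x) ` X)"
    using bounded_scaling[OF assms, of "of_int q ^ n"] by simp
  then obtain B where B: "\<And>x. x \<in> X \<Longrightarrow> \<bar>of_int q ^ n * x\<bar> \<le> B"
    unfolding bounded_iff by auto
  have "adic_cells q n X \<subseteq> {\<lfloor>-B\<rfloor>..\<lfloor>B\<rfloor>}"
    unfolding adic_cells_def using B by (auto simp: abs_le_iff minus_le_iff intro!: floor_mono)
  then show ?thesis
    using finite_subset by blast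
qed

lemma mult_map_eq_frac: "mult_map q x = frac (of_int q * x)"
  by (simp add: mult_map_def frac_def)

text \<open>The iterates of the map have the closed form \<open>x \<mapsto> frac (q ^ k * x)\<close>, because \<open>q\<close> times an
  integer is an integer. The exponent starts at 1, since \<open>frac 1 = 0\<close> differs from the zeroth
  iterate of 1.\<close>

lemma frac_power_mult_mem:
  assumes "mult_map q ` X \<subseteq> X" and "x \<in> X"
  shows "frac (of_int q ^ Suc k * x) \<in> X"
proof (induction k)
  case 0
  then show ?case
    using assms by (auto simp: mult_map_eq_frac)
next
  case (Suc k)
  define y where "y = of_int q ^ Suc k * x"
  have "frac (of_int q * frac y) = frac (of_int q * y)"
    by (simp add: frac_def right_diff_distrib flip: of_int_mult)
  moreover have "mult_map q (frac y) \<in> X"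
    using Suc assms(1) unfolding y_def by blast
  ultimately show ?case
    by (simp add: mult_map_eq_frac y_def mult.assoc)
qed

text \<open>If \<open>x\<close> lies in the cell \<open>a\<close> of rank \<open>k\<close>, then \<open>q\<^sup>k * x = a + y\<close> with \<open>y = frac (q\<^sup>k * x)\<close>
  again in \<open>X\<close>. Hence the rank \<open>n\<close> cell of \<open>x\<close> is the rank \<open>n - k\<close> cell of \<open>y\<close> translated by
  \<open>q\<^sup>n\<^sup>-\<^sup>k * a\<close>: within a cell of rank \<open>k\<close>, the set \<open>X\<close> is no more complicated than \<open>X\<close> itself.\<close>

lemma card_adic_cells_le_sum:
  assumes "bounded X" and inv: "mult_map q ` X \<subseteq> X" and "finite J"
    and cover: "\<And>x. x \<in> X \<Longrightarrow> \<exists>j\<in>J. \<lfloor>of_int q ^ k j * x\<rfloor> = a j"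
    and k: "\<And>j. j \<in> J \<Longrightarrow> 1 \<le> k j \<and> k j \<le> n"
  shows "card (adic_cells q n X) \<le> (\<Sum>j\<in>J. card (adic_cells q (n - k j) X))"
proof -
  have "adic_cells q n X \<subseteq> (\<Union>j\<in>J. (\<lambda>b. q ^ (n - k j) * a j + b) ` adic_cells q (n - k j) X)"
  proof
    fix c assume "c \<in> adic_cells q n X"
    then obtain x where x: "x \<in> X" "c = \<lfloor>of_int q ^ n * x\<rfloor>"
      by (auto simp: adic_cells_def)
    obtain j where j: "j \<in> J" "\<lfloor>of_int q ^ k j * x\<rfloor> = a j"
      using cover[OF x(1)] by blast
    define y where "y = frac (of_int q ^ k j * x)"
    have "y \<in> X"
      using frac_power_mult_mem[OF inv x(1), of "k j - 1"] k[OF j(1)] by (simp add: y_def)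
    have "of_int q ^ n * x = of_int q ^ (n - k j) * (of_int q ^ k j * x)"
      using k[OF j(1)] by (simp flip: power_add mult.assoc)
    also have "of_int q ^ k j * x = of_int (a j) + y"
      using j(2) by (simp add: y_def frac_def)
    finally have "of_int q ^ n * x = of_int (q ^ (n - k j) * a j) + of_int q ^ (n - k j) * y"
      by (simp add: algebra_simps)
    then have "c = q ^ (n - k j) * a j + \<lfloor>of_int q ^ (n - k j) * y\<rfloor>"
      unfolding x(2) by linarith
    then show "c \<in> (\<Union>j\<in>J. (\<lambda>b. q ^ (n - k j) * a j + b) ` adic_cells q (n - k j) X)"
      using j(1) \<open>y \<in> X\<close> unfolding adic_cells_def by blast
  qed
  then have "card (adic_cells q n X)
      \<le> card (\<Union>j\<in>J. (\<lambda>b. q ^ (n - k j) * a j + b) ` adic_cells q (n - k j) X)"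
    using assms by (intro card_mono) (auto intro: finite_adic_cells)
  also have "\<dots> \<le> (\<Sum>j\<in>J. card ((\<lambda>b. q ^ (n - k j) * a j + b) ` adic_cells q (n - k j) X))"
    by (rule card_UN_le) fact
  also have "\<dots> = (\<Sum>j\<in>J. card (adic_cells q (n - k j) X))"
    by (intro sum.cong refl card_image) (auto simp: inj_on_def)
  finally show ?thesis .
qed

text \<open>The weight condition says exactly that \<open>q powr (t * n)\<close> solves the recursive inequality of
  the previous lemma as a supersolution; so growth at this rate propagates by induction.\<close>

lemma adic_cells_growth:
  assumes "q \<ge> 2" "bounded X" "mult_map q ` X \<subseteq> X" "finite J"
    and cover: "\<And>x. x \<in> X \<Longrightarrow> \<exists>j\<in>J. \<lfloor>of_int q ^ k j * x\<rfloor> = a j"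
    and k: "\<And>j. j \<in> J \<Longrightarrow> 1 \<le> k j"
    and weight: "(\<Sum>j\<in>J. of_int q powr (- t * real (k j))) \<le> 1"
  obtains C where "C > 0" "\<And>n. real (card (adic_cells q n X)) \<le> C * of_int q powr (t * real n)"
proof -
  define Q where "Q = real_of_int q"
  have Q: "Q > 0" using assms(1) by (simp add: Q_def)
  define N where "N n = real (card (adic_cells q n X))" for n
  define K where "K = (\<Sum>j\<in>J. k j)"
  have K: "k j \<le> K" if "j \<in> J" for j
    unfolding K_def using that \<open>finite J\<close> by (intro member_le_sum) auto
  \<comment> \<open>Large enough for the ranks below \<open>K\<close>, to which the recursive inequality need not apply.\<close>
  define C where "C = 1 + (\<Sum>m<K. N m * Q powr (- t * m))"
  have "C > 0"
    unfolding C_def N_def by (intro add_pos_nonneg sum_nonneg) auto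
  moreover have "N n \<le> C * Q powr (t * real n)" for n
  proof (induction n rule: less_induct)
    case (less n)
    show ?case
    proof (cases "n < K")
      case True
      have "N n * Q powr (- t * n) \<le> (\<Sum>m<K. N m * Q powr (- t * m))"
        using True by (intro member_le_sum) (auto simp: N_def)
      then have "N n * Q powr (- t * n) \<le> C"
        by (simp add: C_def)
      then have "N n * Q powr (- t * n) * Q powr (t * n) \<le> C * Q powr (t * n)"
        by (rule mult_right_mono) simp
      then show ?thesis
        using Q by (simp add: mult.assoc flip: powr_add)
    next
      case False
      have "N n \<le> (\<Sum>j\<in>J. N (n - k j))"
      proof -
        have "card (adic_cells q n X) \<le> (\<Sum>j\<in>J. card (adic_cells q (n - k j) X))"
          using False K k by (intro card_adic_cells_le_sum[where a = a] assms) force+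
        then show ?thesis
          unfolding N_def by (simp flip: of_nat_sum)
      qed
      also have "\<dots> \<le> (\<Sum>j\<in>J. C * Q powr (t * n) * Q powr (- t * k j))"
      proof (rule sum_mono)
        fix j assume j: "j \<in> J"
        have "k j \<le> n" "1 \<le> k j"
          using K[OF j] k[OF j] False by auto
        then have "N (n - k j) \<le> C * Q powr (t * real (n - k j))"
          by (intro less.IH) linarith
        also have "t * real (n - k j) = t * n + - t * k j"
          using \<open>k j \<le> n\<close> by (simp add: of_nat_diff algebra_simps)
        finally show "N (n - k j) \<le> C * Q powr (t * n) * Q powr (- t * k j)"
          by (simp only: powr_add mult.assoc)
      qed
      also have "\<dots> = C * Q powr (t * n) * (\<Sum>j\<in>J. Q powr (- t * k j))"
        by (simp add: sum_distrib_left)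
      also have "\<dots> \<le> C * Q powr (t * n) * 1"
        using weight \<open>C > 0\<close> unfolding Q_def by (intro mult_left_mono) auto
      finally show ?thesis by simp
    qed
  qed
  ultimately show ?thesis
    using that unfolding N_def Q_def by blast
qed

section \<open>Covering numbers and the upper box dimension\<close>

lemma ex_adic_scale:
  fixes b d :: real
  assumes "b > 1" "0 < d" "d \<le> 1"
  obtains k where "b ^ k \<le> 1 / d" "1 / d < b ^ Suc k"
proof
  define k where "k = nat \<lfloor>log b (1 / d)\<rfloor>"
  have "log b (1 / d) \<ge> 0"
    using assms by simp
  then have k: "real k \<le> log b (1 / d)" "log b (1 / d) < real (Suc k)"
    unfolding k_def by linarith+
  show "b ^ k \<le> 1 / d"
    using k(1) assms by (simp add: le_log_iff powr_realpow)
  show "1 / d < b ^ Suc k"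
    using k(2) assms by (simp only: log_less_iff powr_realpow divide_pos_pos zero_less_one)
qed

lemma covering_number_le_card_adic_cells:
  assumes "q \<ge> 2" "bounded X" and fine: "1 / of_int q ^ n \<le> \<delta>"
  shows "covering_number \<delta> X \<le> card (adic_cells q n X)"
proof -
  define Q where "Q = real_of_int q ^ n"
  have Q: "Q > 0" using assms(1) by (simp add: Q_def)
  define V where "V a = {of_int a / Q .. (of_int a + 1) / Q}" for a
  define \<U> where "\<U> = V ` adic_cells q n X"
  have fin: "finite (adic_cells q n X)"
    by (rule finite_adic_cells) fact
  have V: "diam_le \<delta> (V a)" for a
  proof -
    have "of_int a / Q \<le> (of_int a + 1) / Q"
      using Q by (intro divide_right_mono) auto
    then have "diameter (V a) = 1 / Q"
      by (simp add: V_def diff_divide_distrib[symmetric])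
    then show ?thesis
      using fine by (simp add: diam_le_def Q_def) (simp add: V_def)
  qed
  have "x \<in> V \<lfloor>Q * x\<rfloor>" for x
    using Q by (auto simp: V_def divide_le_eq le_divide_eq mult.commute[of x] add_increasing)
  then have "X \<subseteq> \<Union>\<U>"
    by (auto simp: \<U>_def adic_cells_def Q_def)
  then have "\<exists>\<U>'. finite \<U>' \<and> card \<U>' = card \<U> \<and> X \<subseteq> \<Union>\<U>' \<and> (\<forall>U\<in>\<U>'. diam_le \<delta> U)"
    using fin V by (intro exI[of _ \<U>]) (auto simp: \<U>_def)
  then have "covering_number \<delta> X \<le> card \<U>"
    unfolding covering_number_def by (rule Least_le)
  also have "\<dots> \<le> card (adic_cells q n X)"
    unfolding \<U>_def by (rule card_image_le[OF fin])
  finally show ?thesis .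
qed

text \<open>Compactness provides a finite cover, so the minimum in the definition of the covering number
  is attained.\<close>

lemma covering_number_cover:
  assumes "compact X" "\<delta> > 0"
  obtains \<U> where "finite \<U>" "card \<U> = covering_number \<delta> X" "X \<subseteq> \<Union>\<U>"
    "\<And>U. U \<in> \<U> \<Longrightarrow> diam_le \<delta> U"
proof -
  obtain k where k: "finite k" "X \<subseteq> (\<Union>x\<in>k. ball x (\<delta> / 2))"
    using compact_eq_totally_bounded[of X] assms by (meson half_gt_zero)
  have "diam_le \<delta> (ball x (\<delta> / 2))" for x :: 'a
  proof -
    have "diameter (ball x (\<delta> / 2)) \<le> \<delta>"
    proof -
      have "dist y z \<le> \<delta>" if "y \<in> ball x (\<delta> / 2)" "z \<in> ball x (\<delta> / 2)" for y z
        using that dist_triangle_half_r[of x y \<delta> z] by simp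
      moreover have "ball x (\<delta> / 2) \<noteq> {}"
        using assms(2) by simp
      ultimately show ?thesis
        unfolding diameter_def by (auto intro!: cSUP_least)
    qed
    then show ?thesis by (simp add: diam_le_def)
  qed
  then have "\<exists>n \<U>. finite \<U> \<and> card \<U> = n \<and> X \<subseteq> \<Union>\<U> \<and> (\<forall>U\<in>\<U>. diam_le \<delta> U)"
    using k by (intro exI[of _ "card ((\<lambda>x. ball x (\<delta> / 2)) ` k)"] exI[of _ "(\<lambda>x. ball x (\<delta> / 2)) ` k"])
      auto
  then have "\<exists>\<U>. finite \<U> \<and> card \<U> = covering_number \<delta> X \<and> X \<subseteq> \<Union>\<U> \<and> (\<forall>U\<in>\<U>. diam_le \<delta> U)"
    unfolding covering_number_def by (rule LeastI_ex)
  then show ?thesis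
    using that by blast
qed

lemma covering_number_pos:
  assumes "compact X" "X \<noteq> {}" "\<delta> > 0"
  shows "covering_number \<delta> X > 0"
  using covering_number_cover[OF assms(1,3)] assms(2)
  by (metis Union_empty card_gt_0_iff subset_empty)

lemma eventually_at_right_0_Ioo:
  "(0::real) < b \<Longrightarrow> \<forall>\<^sub>F \<delta> in at_right 0. 0 < \<delta> \<and> \<delta> < b"
  unfolding eventually_at_right_field by auto

lemma upper_box_dim_nonneg:
  assumes "compact X" "X \<noteq> {}"
  shows "upper_box_dim X \<ge> 0"
proof -
  have "\<forall>\<^sub>F \<delta> in at_right 0. 0 \<le> ereal (ln (real (covering_number \<delta> X)) / - ln \<delta>)"
    using eventually_at_right_0_Ioo[OF zero_less_one]
  proof eventually_elim
    case (elim \<delta>)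
    then have "real (covering_number \<delta> X) \<ge> 1"
      using covering_number_pos[OF assms, of \<delta>] by linarith
    then have "0 \<le> ln (real (covering_number \<delta> X)) / - ln \<delta>"
      using elim by (intro divide_nonneg_nonneg) auto
    then show ?case by simp
  qed
  then have "0 \<le> Liminf (at_right 0) (\<lambda>\<delta>. ereal (ln (real (covering_number \<delta> X)) / - ln \<delta>))"
    by (rule Liminf_bounded)
  also have "\<dots> \<le> upper_box_dim X"
    unfolding upper_box_dim_def by (intro Liminf_le_Limsup) simp
  finally show ?thesis .
qed

text \<open>The constant \<open>C\<close> is absorbed in the limit because \<open>ln C / - ln \<delta>\<close> tends to 0.\<close>

lemma upper_box_dim_le_of_covering_number:
  fixes X :: "'a::metric_space set"
  assumes "compact X" "X \<noteq> {}" "C > 0"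
    and bound: "\<And>\<delta>. 0 < \<delta> \<Longrightarrow> \<delta> < 1 \<Longrightarrow> real (covering_number \<delta> X) \<le> C * \<delta> powr (- t)"
  shows "upper_box_dim X \<le> ereal t"
proof -
  have ev: "\<forall>\<^sub>F \<delta> in at_right 0. ereal (ln (real (covering_number \<delta> X)) / - ln \<delta>)
      \<le> ereal (ln C / - ln \<delta> + t)"
    using eventually_at_right_0_Ioo[OF zero_less_one]
  proof eventually_elim
    case (elim \<delta>)
    then have "ln (real (covering_number \<delta> X)) \<le> ln (C * \<delta> powr (- t))"
      using bound covering_number_pos[OF assms(1,2), of \<delta>] by (intro ln_mono) auto
    also have "\<dots> = ln C + t * - ln \<delta>"
      using elim \<open>C > 0\<close> by (simp add: ln_mult ln_powr)
    finally have "ln (real (covering_number \<delta> X)) / - ln \<delta> \<le> (ln C + t * - ln \<delta>) / - ln \<delta>"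
      using elim by (intro divide_right_mono) auto
    also have "\<dots> = ln C / - ln \<delta> + t"
      using elim by (simp add: field_simps)
    finally show ?case by simp
  qed
  have "((\<lambda>\<delta>. ln C / - ln \<delta>) \<longlongrightarrow> 0) (at_right (0::real))"
    using ln_at_0 by (intro real_tendsto_divide_at_top[OF tendsto_const])
      (simp only: filterlim_uminus_at_bot)
  then have "((\<lambda>\<delta>. ereal (ln C / - ln \<delta> + t)) \<longlongrightarrow> ereal (0 + t)) (at_right (0::real))"
    by (intro tendsto_intros)
  then have "Limsup (at_right 0) (\<lambda>\<delta>::real. ereal (ln C / - ln \<delta> + t)) = ereal t"
    by (intro lim_imp_Limsup) auto
  then show ?thesis
    using Limsup_mono[OF ev] by (simp add: upper_box_dim_def)
qed

text \<open>Box counting may be restricted to the scales \<open>q ^ - k\<close>: any other \<open>\<delta>\<close> lies within a factor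
  \<open>q\<close> of one of them, which costs only the constant \<open>q powr t\<close>.\<close>

lemma upper_box_dim_le_of_adic_growth:
  assumes "q \<ge> 2" "compact X" "X \<noteq> {}" "C > 0" "t \<ge> 0"
    and growth: "\<And>n. real (card (adic_cells q n X)) \<le> C * of_int q powr (t * real n)"
  shows "upper_box_dim X \<le> ereal t"
proof (rule upper_box_dim_le_of_covering_number)
  show "C * of_int q powr t > 0" using assms by simp
  fix \<delta> :: real assume \<delta>: "0 < \<delta>" "\<delta> < 1"
  have q: "real_of_int q > 1" using assms by simp
  obtain k where k: "of_int q ^ k \<le> 1 / \<delta>" "1 / \<delta> < of_int q ^ Suc k"
    using ex_adic_scale[OF q \<delta>(1)] \<delta>(2) by force
  have "1 / of_int q ^ Suc k \<le> \<delta>"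
    using k(2) \<delta> q by (simp add: field_simps)
  then have "real (covering_number \<delta> X) \<le> real (card (adic_cells q (Suc k) X))"
    using covering_number_le_card_adic_cells assms compact_imp_bounded of_nat_mono by blast
  also have "\<dots> \<le> C * of_int q powr (t * real (Suc k))"
    by (rule growth)
  also have "of_int q powr (t * real (Suc k)) = of_int q powr t * (of_int q ^ k) powr t"
    using q by (simp add: powr_add powr_powr algebra_simps flip: powr_realpow)
  also have "C * \<dots> \<le> C * (of_int q powr t * (1 / \<delta>) powr t)"
    using k(1) q assms \<delta> by (intro mult_left_mono powr_mono2) auto
  also have "(1 / \<delta>) powr t = \<delta> powr (- t)"
    using \<delta> by (simp add: powr_divide powr_minus_divide)
  finally show "real (covering_number \<delta> X) \<le> C * of_int q powr t * \<delta> powr (- t)"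
    by (simp add: mult.assoc)
qed (use assms in auto)

section \<open>From arbitrary covers to finite covers by cells\<close>

text \<open>Sets of diameter 0 get an interval of positive length at an arbitrarily small price, because
  \<open>s > 0\<close>.\<close>

lemma open_interval_enlargement:
  fixes U :: "real set"
  assumes "bounded U" "s > 0" "\<eta> > 0"
  obtains l d where "d > 0" "U \<subseteq> {l<..<l + d}" "d powr s \<le> diameter U powr s + \<eta>"
proof -
  have "((\<lambda>e. (diameter U + 2 * e) powr s) \<longlongrightarrow> (diameter U + 2 * 0) powr s) (at_right 0)"
  proof (rule tendsto_powr')
    show "((\<lambda>e. diameter U + 2 * e) \<longlongrightarrow> diameter U + 2 * 0) (at_right 0)"
      by (intro tendsto_intros)
    show "diameter U + 2 * 0 \<noteq> 0 \<or> 0 < s \<and> (\<forall>\<^sub>F e in at_right 0. 0 \<le> diameter U + 2 * e)"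
      using eventually_at_right_0_Ioo[OF zero_less_one] diameter_ge_0[OF assms(1)] assms(2)
      by (auto elim!: eventually_mono)
  qed auto
  then have "\<forall>\<^sub>F e in at_right 0. (diameter U + 2 * e) powr s < diameter U powr s + \<eta>"
    using assms(3) by (intro order_tendstoD(2)) auto
  then have "\<forall>\<^sub>F e in at_right 0. (diameter U + 2 * e) powr s < diameter U powr s + \<eta> \<and> 0 < e \<and> e < 1"
    using eventually_at_right_0_Ioo[OF zero_less_one] by eventually_elim auto
  then obtain e where e: "(diameter U + 2 * e) powr s < diameter U powr s + \<eta>" "0 < e"
    using eventually_happens by fastforce
  show ?thesis
  proof
    show "diameter U + 2 * e > 0"
      using e diameter_ge_0[OF assms(1)] by linarith
    show "U \<subseteq> {Inf U - e<..<Inf U - e + (diameter U + 2 * e)}"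
    proof
      fix x assume x: "x \<in> U"
      have lower: "Inf U \<le> x"
        using x assms(1) by (intro cInf_lower bounded_imp_bdd_below)
      have "x - diameter U \<le> Inf U"
      proof (rule cInf_greatest)
        fix y assume "y \<in> U"
        then show "x - diameter U \<le> y"
          using diameter_bounded_bound[OF assms(1) x] by (fastforce simp: dist_real_def)
      qed (use x in auto)
      then show "x \<in> {Inf U - e<..<Inf U - e + (diameter U + 2 * e)}"
        using lower e by auto
    qed
  qed (use e in auto)
qed

text \<open>The slack between the content and \<open>c\<close> is distributed geometrically over the members of the
  cover, paying for their enlargement to open intervals; compactness then selects finitely many.\<close>

lemma finite_interval_cover_of_content_less:
  fixes X :: "real set"
  assumes "compact X" "s > 0" "hausdorff_content s \<delta> X < ennreal c"
  obtains F :: "nat set" and l d where "finite F" "\<And>j. j \<in> F \<Longrightarrow> d j > 0"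
    "X \<subseteq> (\<Union>j\<in>F. {l j<..<l j + d j})" "(\<Sum>j\<in>F. d j powr s) < c"
proof -
  obtain U where U: "X \<subseteq> (\<Union>j. U j)" "\<And>j::nat. diam_le \<delta> (U j)"
      "(\<Sum>j. diam_pow s (U j)) < ennreal c"
    using assms(3) unfolding hausdorff_content_def Inf_less_iff by auto
  have dp: "diam_pow s (U j) = ennreal (diameter (U j) powr s)" for j
    using assms(2) by (simp add: diam_pow_def diameter_empty)
  obtain \<sigma> where \<sigma>: "(\<Sum>j. diam_pow s (U j)) = ennreal \<sigma>" "\<sigma> \<ge> 0"
    using U(3) by (cases "\<Sum>j. diam_pow s (U j)") auto
  have "\<sigma> < c"
    using U(3) \<sigma> by (simp add: ennreal_less_iff)
  \<comment> \<open>The total is half of the slack, so that the final bound stays strict.\<close>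
  define \<eta> where "\<eta> j = (c - \<sigma>) / 2 * (1 / 2) ^ Suc j" for j :: nat
  have \<eta>: "\<eta> j > 0" for j
    using \<open>\<sigma> < c\<close> by (simp add: \<eta>_def)
  have "\<forall>j. \<exists>l d. d > 0 \<and> U j \<subseteq> {l<..<l + d} \<and> d powr s \<le> diameter (U j) powr s + \<eta> j"
    using open_interval_enlargement[OF _ assms(2) \<eta>] U(2) unfolding diam_le_def by metis
  then obtain l d where ld: "\<And>j. d j > 0" "\<And>j. U j \<subseteq> {l j<..<l j + d j}"
      "\<And>j. d j powr s \<le> diameter (U j) powr s + \<eta> j"
    by metis
  have "X \<subseteq> (\<Union>j\<in>UNIV. {l j<..<l j + d j})"
    using U(1) ld(2) by blast
  then obtain F where F: "finite F" "X \<subseteq> (\<Union>j\<in>F. {l j<..<l j + d j})"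
    using compactE_image[OF assms(1), of UNIV "\<lambda>j. {l j<..<l j + d j}"] by auto
  have "(\<Sum>j\<in>F. d j powr s) \<le> (\<Sum>j\<in>F. diameter (U j) powr s) + (\<Sum>j\<in>F. \<eta> j)"
    using ld(3) by (simp add: sum_mono flip: sum.distrib)
  also have "(\<Sum>j\<in>F. diameter (U j) powr s) \<le> \<sigma>"
  proof -
    have "ennreal (\<Sum>j\<in>F. diameter (U j) powr s) = (\<Sum>j\<in>F. diam_pow s (U j))"
      by (simp add: dp sum_ennreal)
    also have "\<dots> \<le> ennreal \<sigma>"
      unfolding \<sigma>(1)[symmetric] by (intro sum_le_suminf F) auto
    finally show ?thesis
      using \<sigma>(2) by (simp add: ennreal_le_iff)
  qed
  also have "(\<Sum>j\<in>F. \<eta> j) \<le> (c - \<sigma>) / 2"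
  proof -
    have "\<eta> sums ((c - \<sigma>) / 2 * 1)"
      unfolding \<eta>_def by (intro sums_mult power_half_series)
    then show ?thesis
      using sum_le_suminf[of \<eta> F] F(1) less_imp_le[OF \<eta>] by (simp add: sums_iff)
  qed
  finally have "(\<Sum>j\<in>F. d j powr s) < c"
    using \<open>\<sigma> < c\<close> by (simp add: field_simps)
  then show ?thesis
    using that F ld(1) by blast
qed

text \<open>The rank is the largest one whose cells are at least as long as the interval: then the
  interval crosses at most one cell boundary, and cells of the next rank would be shorter than \<open>d\<close>,
  which gives the upper bound \<open>q * d\<close> for the length.\<close>

lemma interval_in_two_adic_cells:
  fixes l d :: real
  assumes "q \<ge> 2" "0 < d" "d \<le> 1"
  obtains k where "1 / of_int q ^ k \<le> of_int q * d"
    "\<And>x. x \<in> {l<..<l + d} \<Longrightarrow> \<exists>i\<in>{0, 1}. \<lfloor>of_int q ^ k * x\<rfloor> = \<lfloor>of_int q ^ k * l\<rfloor> + i"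
proof -
  have q: "real_of_int q > 1" using assms by simp
  obtain k where k: "of_int q ^ k \<le> 1 / d" "1 / d < of_int q ^ Suc k"
    using ex_adic_scale[OF q assms(2,3)] .
  show ?thesis
  proof
    show "1 / of_int q ^ k \<le> of_int q * d"
      using k(2) q assms by (simp add: field_simps)
    fix x assume x: "x \<in> {l<..<l + d}"
    have "of_int q ^ k * l \<le> of_int q ^ k * x" "of_int q ^ k * x < of_int q ^ k * (l + d)"
      using x q by auto
    moreover have "of_int q ^ k * (l + d) \<le> of_int q ^ k * l + 1"
      using k(1) assms by (simp add: field_simps)
    ultimately have "\<lfloor>of_int q ^ k * x\<rfloor> = \<lfloor>of_int q ^ k * l\<rfloor> \<or> \<lfloor>of_int q ^ k * x\<rfloor> = \<lfloor>of_int q ^ k * l\<rfloor> + 1"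
      by linarith
    then show "\<exists>i\<in>{0, 1}. \<lfloor>of_int q ^ k * x\<rfloor> = \<lfloor>of_int q ^ k * l\<rfloor> + i"
      by auto
  qed
qed

text \<open>The strict inequality for the weight leaves room to decrease the exponent, as a finite sum of
  powers is continuous in it; the count of cells then grows at a rate below \<open>s\<close>.\<close>

lemma upper_box_dim_less_of_adic_cover:
  assumes "q \<ge> 2" "compact X" "X \<noteq> {}" "mult_map q ` X \<subseteq> X" "finite J" "s > 0"
    and cover: "\<And>x. x \<in> X \<Longrightarrow> \<exists>j\<in>J. \<lfloor>of_int q ^ k j * x\<rfloor> = a j"
    and weight: "(\<Sum>j\<in>J. of_int q powr (- s * real (k j))) < 1"
  shows "upper_box_dim X < ereal s"
proof -
  have q: "real_of_int q > 0" using assms by simp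
  \<comment> \<open>A cell of rank 0 would already have weight 1.\<close>
  have k: "1 \<le> k j" if "j \<in> J" for j
  proof (rule ccontr)
    assume "\<not> 1 \<le> k j"
    then have "k j = 0"
      by simp
    then have "1 = of_int q powr (- s * real (k j))"
      using q by simp
    also have "\<dots> \<le> (\<Sum>j\<in>J. of_int q powr (- s * real (k j)))"
      using that assms(5) by (intro member_le_sum) auto
    finally show False using weight by simp
  qed
  have "((\<lambda>t. \<Sum>j\<in>J. of_int q powr (- t * real (k j)))
      \<longlongrightarrow> (\<Sum>j\<in>J. of_int q powr (- s * real (k j)))) (at_left s)"
    using q by (intro tendsto_intros) auto
  then have "\<forall>\<^sub>F t in at_left s. (\<Sum>j\<in>J. of_int q powr (- t * real (k j))) < 1"
    using weight by (rule order_tendstoD(2))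
  moreover have "\<forall>\<^sub>F t in at_left s. 0 < t \<and> t < s"
    using assms(6) unfolding eventually_at_left_field by auto
  ultimately have "\<forall>\<^sub>F t in at_left s. (\<Sum>j\<in>J. of_int q powr (- t * real (k j))) < 1 \<and> 0 < t \<and> t < s"
    by eventually_elim auto
  then obtain t where t: "(\<Sum>j\<in>J. of_int q powr (- t * real (k j))) < 1" "0 < t" "t < s"
    using eventually_happens by fastforce
  obtain C where "C > 0" "\<And>n. real (card (adic_cells q n X)) \<le> C * of_int q powr (t * real n)"
    using adic_cells_growth[OF assms(1) compact_imp_bounded[OF assms(2)] assms(4,5) cover k]
      t(1) by (metis less_imp_le)
  then have "upper_box_dim X \<le> ereal t"
    using assms t by (intro upper_box_dim_le_of_adic_growth) auto
  also have "\<dots> < ereal s"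
    using t by simp
  finally show ?thesis .
qed

section \<open>The lower bound for the Hausdorff contents\<close>

lemma one_le_hausdorff_content_0:
  assumes "X \<noteq> {}"
  shows "1 \<le> hausdorff_content 0 \<delta> X"
  unfolding hausdorff_content_def
proof (rule Inf_greatest, safe)
  fix U :: "nat \<Rightarrow> 'a set"
  assume "X \<subseteq> (\<Union>j. U j)"
  then obtain j where "U j \<noteq> {}"
    using assms by fastforce
  then have "1 = diam_pow 0 (U j)"
    by (simp add: diam_pow_def)
  also have "\<dots> \<le> (\<Sum>j. diam_pow 0 (U j))"
    using sum_le_suminf[of "\<lambda>j. diam_pow 0 (U j)" "{j}"] by simp
  finally show "1 \<le> (\<Sum>j. diam_pow 0 (U j))" .
qed

text \<open>A cover violating the bound would yield a cover by cells of total weight less than 1. The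
  factor 2 in the bound counts the two cells per interval, and \<open>q powr (- s)\<close> compensates the
  ratio of at most \<open>q\<close> between the lengths of cell and interval. The exponent 0 is separate: an
  empty member of the cover has weight 0, but any enlargement of it weighs 1. In that case
  every cover of a nonempty set trivially has sum at least 1.\<close>

lemma hausdorff_content_ge:
  assumes "q \<ge> 2" "compact X" "X \<noteq> {}" "mult_map q ` X \<subseteq> X" "s \<ge> 0"
    and dim: "ereal s \<le> upper_box_dim X"
  shows "ennreal (of_int q powr (- s) / 2) \<le> hausdorff_content s \<delta> X"
proof (cases "s = 0")
  case True
  have "ennreal (of_int q powr (- s) / 2) \<le> ennreal 1"
    using assms(1) True by (intro ennreal_leI) simp
  also have "ennreal 1 \<le> hausdorff_content s \<delta> X"
    unfolding ennreal_1 using True one_le_hausdorff_content_0 assms(3) by blast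
  finally show ?thesis .
next
  case False
  then have s: "s > 0" using assms by simp
  have q: "real_of_int q > 1" using assms by simp
  show ?thesis
  proof (rule ccontr)
    assume "\<not> ?thesis"
    then have "hausdorff_content s \<delta> X < ennreal (of_int q powr (- s) / 2)"
      by simp
    then obtain F :: "nat set" and l d where F: "finite F" "\<And>j. j \<in> F \<Longrightarrow> d j > 0"
        "X \<subseteq> (\<Union>j\<in>F. {l j<..<l j + d j})" "(\<Sum>j\<in>F. d j powr s) < of_int q powr (- s) / 2"
      by (rule finite_interval_cover_of_content_less[OF assms(2) s]) blast
    \<comment> \<open>An interval longer than 1 would by itself exceed the bound on the sum, at any scale \<open>\<delta>\<close>.\<close>
    have d1: "d j \<le> 1" if "j \<in> F" for j
    proof (rule ccontr)
      assume "\<not> d j \<le> 1"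
      then have "1 \<le> d j powr s"
        using s by (intro ge_one_powr_ge_zero) auto
      also have "\<dots> \<le> (\<Sum>j\<in>F. d j powr s)"
        using that F(1) by (intro member_le_sum) auto
      also have "\<dots> < 1"
        using F(4) q s powr_mono[of "- s" 0 "of_int q"] by simp
      finally show False by simp
    qed
    have "\<forall>j\<in>F. \<exists>k. 1 / of_int q ^ k \<le> of_int q * d j \<and>
        (\<forall>x\<in>{l j<..<l j + d j}. \<exists>i\<in>{0, 1}. \<lfloor>of_int q ^ k * x\<rfloor> = \<lfloor>of_int q ^ k * l j\<rfloor> + i)"
      using interval_in_two_adic_cells[OF assms(1)] F(2) d1 by metis
    then obtain k where k: "\<And>j. j \<in> F \<Longrightarrow> 1 / of_int q ^ k j \<le> of_int q * d j"
      "\<And>j x. j \<in> F \<Longrightarrow> x \<in> {l j<..<l j + d j} \<Longrightarrow>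
         \<exists>i\<in>{0, 1}. \<lfloor>of_int q ^ k j * x\<rfloor> = \<lfloor>of_int q ^ k j * l j\<rfloor> + i"
      by metis
    \<comment> \<open>The index \<open>(j, i)\<close> stands for the left or the right one of the two cells containing the
      \<open>j\<close>-th interval.\<close>
    have "(\<Sum>p\<in>F \<times> {0, 1::int}. of_int q powr (- s * real (k (fst p))))
        = (\<Sum>j\<in>F. 2 * of_int q powr (- s * real (k j)))"
      by (simp add: sum.cartesian_product' )
    also have "\<dots> \<le> (\<Sum>j\<in>F. 2 * (of_int q powr s * d j powr s))"
    proof (intro sum_mono mult_left_mono)
      fix j assume j: "j \<in> F"
      have "of_int q powr (- s * real (k j)) = (1 / of_int q ^ k j) powr s"
        using q by (simp add: powr_divide powr_powr powr_minus_divide mult.commute flip: powr_realpow)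
      also have "\<dots> \<le> (of_int q * d j) powr s"
        using k(1)[OF j] q s by (intro powr_mono2) auto
      also have "\<dots> = of_int q powr s * d j powr s"
        using q F(2)[OF j] by (simp add: powr_mult)
      finally show "of_int q powr (- s * real (k j)) \<le> of_int q powr s * d j powr s" .
    qed auto
    also have "\<dots> = 2 * of_int q powr s * (\<Sum>j\<in>F. d j powr s)"
      by (simp add: sum_distrib_left mult.assoc)
    also have "\<dots> < 2 * of_int q powr s * (of_int q powr (- s) / 2)"
      using F(4) q by (intro mult_strict_left_mono) auto
    also have "\<dots> = 1"
      using q by (simp flip: powr_add)
    finally have weight: "(\<Sum>p\<in>F \<times> {0, 1::int}. of_int q powr (- s * real (k (fst p)))) < 1" .
    have "upper_box_dim X < ereal s"
    proof (rule upper_box_dim_less_of_adic_cover[OF assms(1-4) _ s _ weight])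
      fix x assume "x \<in> X"
      then show "\<exists>p\<in>F \<times> {0, 1}. \<lfloor>of_int q ^ k (fst p) * x\<rfloor> = \<lfloor>of_int q ^ k (fst p) * l (fst p)\<rfloor> + snd p"
        using F(3) k(2) by fastforce
    qed (use F(1) in auto)
    then show False
      using dim by simp
  qed
qed

section \<open>Comparison of the two dimensions\<close>

lemma hausdorff_content_le_measure:
  "\<delta> > 0 \<Longrightarrow> hausdorff_content s \<delta> X \<le> hausdorff_measure s X"
  unfolding hausdorff_measure_eq_SUP by (rule SUP_upper) simp

text \<open>Powers of a number in \<open>[0, 1]\<close> decrease with the exponent. The convention that nonempty sets
  have weight 1 for exponent 0 keeps this true for diameter 0.\<close>

lemma hausdorff_content_antimono_exponent:
  assumes "0 \<le> t" "t \<le> s" "\<delta> \<le> 1"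
  shows "hausdorff_content s \<delta> X \<le> hausdorff_content t \<delta> X"
  unfolding hausdorff_content_def
proof (rule Inf_mono, safe)
  fix U :: "nat \<Rightarrow> 'a set"
  assume U: "X \<subseteq> (\<Union>j. U j)" "\<forall>j. diam_le \<delta> (U j)"
  have "diam_pow s (U j) \<le> diam_pow t (U j)" for j
  proof -
    have "0 \<le> diameter (U j)" "diameter (U j) \<le> 1"
      using U(2) assms(3) by (auto simp: diam_le_def diameter_ge_0 intro: order_trans)
    then show ?thesis
      using assms by (auto simp: diam_pow_def ennreal_le_1 intro!: ennreal_leI powr_mono' powr_le1)
  qed
  then have "(\<Sum>j. diam_pow s (U j)) \<le> (\<Sum>j. diam_pow t (U j))"
    by (intro suminf_le) auto
  then show "\<exists>a\<in>{\<Sum>j. diam_pow s (U j) |U. X \<subseteq> (\<Union>j. U j) \<and> (\<forall>j. diam_le \<delta> (U j))}.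
      a \<le> (\<Sum>j. diam_pow t (U j))"
    using U by blast
qed

lemma hausdorff_content_le_covering_number:
  assumes "compact X" "\<delta> > 0" "t > 0"
  shows "hausdorff_content t \<delta> X \<le> ennreal (real (covering_number \<delta> X) * \<delta> powr t)"
proof -
  obtain \<U> where \<U>: "finite \<U>" "card \<U> = covering_number \<delta> X" "X \<subseteq> \<Union>\<U>"
      "\<And>U. U \<in> \<U> \<Longrightarrow> diam_le \<delta> U"
    by (rule covering_number_cover[OF assms(1,2)]) blast
  define n where "n = covering_number \<delta> X"
  obtain f where f: "bij_betw f {..<n} \<U>"
    using ex_bij_betw_nat_finite[OF \<U>(1)] \<U>(2) by (auto simp: n_def atLeast0LessThan)
  define U where "U j = (if j < n then f j else {})" for j
  have "\<Union>\<U> = (\<Union>j. U j)"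
    using f by (auto simp: bij_betw_def U_def split: if_splits)
  moreover have U: "diam_le \<delta> (U j)" for j
    using f \<U>(4) assms(2) by (auto simp: U_def bij_betw_def diam_le_def diameter_empty)
  ultimately have "hausdorff_content t \<delta> X \<le> (\<Sum>j. diam_pow t (U j))"
    unfolding hausdorff_content_def using \<U>(3) by (intro Inf_lower) auto
  also have "\<dots> = (\<Sum>j<n. diam_pow t (U j))"
    by (rule suminf_finite) (auto simp: U_def diam_pow_def)
  also have "\<dots> \<le> (\<Sum>j<n. ennreal (\<delta> powr t))"
  proof (rule sum_mono)
    fix j
    have "diameter (U j) powr t \<le> \<delta> powr t"
      using U[of j] assms(3) by (intro powr_mono2) (auto simp: diam_le_def diameter_ge_0)
    then show "diam_pow t (U j) \<le> ennreal (\<delta> powr t)"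
      using assms(3) by (auto simp: diam_pow_def ennreal_leI)
  qed
  also have "\<dots> = ennreal (real n * \<delta> powr t)"
    by (simp add: ennreal_mult' ennreal_of_nat_eq_real_of_nat)
  finally show ?thesis by (simp add: n_def)
qed

text \<open>With \<open>u\<close> strictly between the upper box dimension and \<open>t\<close>, a cover by at most
  \<open>\<delta> powr (- u)\<close> sets of diameter at most \<open>\<delta>\<close> shows that the content at scale \<open>\<delta>\<close> is at most
  \<open>\<delta> powr (t - u)\<close>, which tends to 0.\<close>

lemma hausdorff_measure_eq_0_of_upper_box_dim_less:
  assumes "compact X" "X \<noteq> {}" "upper_box_dim X < ereal t"
  shows "hausdorff_measure t X = 0"
proof -
  obtain u where u: "upper_box_dim X < ereal u" "u < t"
    using ereal_dense2[OF assms(3)] by auto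
  have "0 \<le> upper_box_dim X"
    by (rule upper_box_dim_nonneg) fact+
  then have "t > 0"
    using assms(3) by (metis ereal_less(2) le_less_trans)
  have "\<forall>\<^sub>F \<delta> in at_right 0. ereal (ln (real (covering_number \<delta> X)) / - ln \<delta>) < ereal u"
    using u(1) unfolding upper_box_dim_def by (rule Limsup_lessD)
  then have small: "\<forall>\<^sub>F \<delta> in at_right 0. hausdorff_content t \<delta> X \<le> ennreal (\<delta> powr (t - u))"
    using eventually_at_right_0_Ioo[OF zero_less_one]
  proof eventually_elim
    case (elim \<delta>)
    have pos: "0 < real (covering_number \<delta> X)"
      using covering_number_pos[OF assms(1,2)] elim by simp
    have "ln (real (covering_number \<delta> X)) \<le> ln (\<delta> powr (- u))"
      using elim by (simp add: ln_powr field_simps)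
    then have "real (covering_number \<delta> X) \<le> \<delta> powr (- u)"
      using pos elim by (subst (asm) ln_le_cancel_iff) auto
    then have "real (covering_number \<delta> X) * \<delta> powr t \<le> \<delta> powr (- u) * \<delta> powr t"
      by (rule mult_right_mono) simp
    also have "\<dots> = \<delta> powr (t - u)"
      by (simp flip: powr_add)
    finally show ?case
      using hausdorff_content_le_covering_number[OF assms(1) _ \<open>t > 0\<close>] elim
      by (meson ennreal_leI order_trans)
  qed
  have "((\<lambda>\<delta>::real. \<delta> powr (t - u)) \<longlongrightarrow> 0 powr (t - u)) (at_right 0)"
    using u(2) eventually_at_right_0_Ioo[OF zero_less_one]
    by (intro tendsto_powr') (auto elim!: eventually_mono)
  then have "((\<lambda>\<delta>::real. ennreal (\<delta> powr (t - u))) \<longlongrightarrow> ennreal 0) (at_right 0)"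
    by (intro tendsto_ennrealI) simp
  then have "(SUP \<delta>\<in>{0<..}. hausdorff_content t \<delta> X) \<le> ennreal 0"
    by (rule tendsto_le[OF trivial_limit_at_right_real _ hausdorff_content_tendsto small])
  then show ?thesis
    by (simp add: hausdorff_measure_eq_SUP)
qed

lemma hausdorff_dim_le_upper_box_dim:
  assumes "compact X" "X \<noteq> {}"
  shows "hausdorff_dim X \<le> upper_box_dim X"
proof (rule ccontr)
  assume "\<not> hausdorff_dim X \<le> upper_box_dim X"
  then obtain t where t: "upper_box_dim X < ereal t" "ereal t < hausdorff_dim X"
    using ereal_dense2[of "upper_box_dim X" "hausdorff_dim X"] by (auto simp: not_le)
  have "t \<ge> 0"
    using le_less_trans[OF upper_box_dim_nonneg[OF assms] t(1)] by simp
  then have "hausdorff_dim X \<le> ereal t"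
    unfolding hausdorff_dim_def
    using hausdorff_measure_eq_0_of_upper_box_dim_less[OF assms t(1)]
    by (intro Inf_lower) auto
  then show False
    using t(2) by simp
qed

section \<open>Hausdorff measure and dimension of invariant compact sets\<close>

theorem lemma3p2:
  fixes q :: int and X :: "real set" and s :: real
  assumes "q \<ge> 2"
    and "X \<subseteq> {0..1}" and "X \<noteq> {}" and "compact X"
    and "mult_map q ` X \<subseteq> X"
    and "upper_box_dim X = ereal s"
  shows "hausdorff_measure s X \<ge> ennreal (real_of_int q powr (- s) / 2)
       \<and> upper_box_dim X = hausdorff_dim X"
proof
  have s: "s \<ge> 0"
    using upper_box_dim_nonneg[OF assms(4,3)] assms(6) by simp
  have content: "ennreal (real_of_int q powr (- s) / 2) \<le> hausdorff_content s 1 X"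
    using assms s by (intro hausdorff_content_ge) auto
  then show "hausdorff_measure s X \<ge> ennreal (real_of_int q powr (- s) / 2)"
    by (rule order_trans) (simp add: hausdorff_content_le_measure)
  have "ereal s \<le> hausdorff_dim X"
    unfolding hausdorff_dim_def
  proof (rule Inf_greatest, safe)
    fix t assume t: "t \<ge> 0" "hausdorff_measure t X = 0"
    \<comment> \<open>Otherwise the positive content of exponent \<open>s\<close> would be below the vanishing one of
      exponent \<open>t\<close>.\<close>
    show "ereal s \<le> ereal t"
    proof (rule ccontr)
      assume "\<not> ereal s \<le> ereal t"
      then have "hausdorff_content s 1 X \<le> hausdorff_content t 1 X"
        using t(1) by (intro hausdorff_content_antimono_exponent) auto
      also have "\<dots> \<le> 0"
        using hausdorff_content_le_measure[of 1 t X] t(2) by simp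
      finally have "ennreal (real_of_int q powr (- s) / 2) \<le> 0"
        using content by simp
      then show False
        using assms(1) by (simp add: ennreal_eq_0_iff)
    qed
  qed
  then show "upper_box_dim X = hausdorff_dim X"
    using hausdorff_dim_le_upper_box_dim[OF assms(4,3)] assms(6) by simp
qed

end
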